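(* Let $X$ and $Y$ be real Banach spaces with origins $\theta_X,\theta_Y$, let $C\subseteq X$ and $K\subseteq Y$ be closed convex pointed cones with $C\neq\{\theta_X\}$ and $K\neq\{\theta_Y\}$, let $A\subseteq X$ be a nonempty convex open set, and let $T:A\to Y$ be a mapping. Suppose that $T$ is Gâteaux differentiable on $A$. If $T$ is order increasing on $A$, then for every $\bar x\in A$, $$T'(\bar x)(v)\succcurlyeq_K\theta_Y\quad\text{for every } v\in C\setminus\{\theta_X\}.$$ In particular, if $T$ is Fréchet differentiable on $A$ and order increasing on $A$, then for every $\bar x\in A$, $$\nabla T(\bar x)(v)=T'(\bar x)(v)\succcurlyeq_K\theta_Y\quad\text{for every } v\in C\setminus\{\theta_X\}.$$
   Context: The partial orders are $x_1\preccurlyeq_C x_2\iff x_2-x_1\in C$ on $X$ and $y_1\preccurlyeq_K y_2\iff y_2-y_1\in K$ on $Y$; pointed means $C\cap(-C)=\{\theta_X\}$ (similarly for $K$). $T$ is order increasing on $A$ if for all $x_1,x_2\in A$, $x_1\preccurlyeq_C x_2$ implies $T(x_1)\preccurlyeq_K T(x_2)$. $T$ is Gâteaux differentiable at $\bar x$ if for every $v\in X\setminus\{\theta_X\}$ the norm limit $T'(\bar x)(v)=\lim_{t\to0}\frac{T(\bar x+tv)-T(\bar x)}{t}$ ($t$ real) exists in $Y$. $T$ is Fréchet differentiable at $\bar x$ with derivative $\nabla T(\bar x)$ if $\nabla T(\bar x):X\to Y$ is continuous linear and $\lim_{u\to\theta_X}\frac{T(\bar x+u)-T(\bar x)-\nabla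 T(\bar x)(u)}{\|u\|_X}=\theta_Y$. Differentiable on $A$ means at every point of $A$. *)

theory Defs
  imports "HOL-Analysis.Analysis"
begin

definition cone_le :: "'a::real_vector set \<Rightarrow> 'a \<Rightarrow> 'a \<Rightarrow> bool" where
  "cone_le C x y \<longleftrightarrow> y - x \<in> C"

(* The library predicate "cone" holds for the empty set; the equation in "pointed" excludes it. *)
definition pointed :: "'a::real_vector set \<Rightarrow> bool" where
  "pointed C \<longleftrightarrow> C \<inter> uminus ` C = {0}"

definition gateaux_differentiable ::
  "('a::real_normed_vector \<Rightarrow> 'b::real_normed_vector) \<Rightarrow> 'a \<Rightarrow> bool" where
  "gateaux_differentiable T x \<longleftrightarrow>
     (\<forall>v. v \<noteq> 0 \<longrightarrow> (\<exists>l. ((\<lambda>t::real. (T (x + t *\<^sub>R v) - T x) /\<^sub>R t) \<longlongrightarrow> l) (at 0)))"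

(* Linearity and continuity in v are not required. "Lim" is a definite description, so the
   value is meaningful only where the limit exists. *)
definition gateaux_deriv ::
  "('a::real_normed_vector \<Rightarrow> 'b::real_normed_vector) \<Rightarrow> 'a \<Rightarrow> 'a \<Rightarrow> 'b" where
  "gateaux_deriv T x v = Lim (at 0) (\<lambda>t::real. (T (x + t *\<^sub>R v) - T x) /\<^sub>R t)"

end

(* Directional derivatives of an increasing map are limits, as t decreases to 0, of difference
   quotients lying in the closed cone K. *)
theory Submission
  imports Defs
begin

text \<open>For \<open>v\<close> in \<open>C\<close> and small \<open>t > 0\<close>, the point
  \<open>x + t *\<^sub>R v\<close> lies in \<open>A\<close> and above \<open>x\<close>, so
  monotonicity puts the increment of \<open>T\<close> in \<open>K\<close>, and dividing by
  \<open>t\<close> keeps it there. Closedness of \<open>K\<close> carries membership over to the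
  limit; this is \<open>cone_le_gateaux_deriv\<close>. The Frechet case reduces to this one, because
  by \<open>has_derivative_directional_tendsto\<close> a Frechet derivative supplies every
  directional limit, and limits are unique.\<close>

lemma gateaux_deriv_tendsto:
  assumes "gateaux_differentiable T x" and "v \<noteq> 0"
  shows "((\<lambda>t::real. (T (x + t *\<^sub>R v) - T x) /\<^sub>R t) \<longlongrightarrow> gateaux_deriv T x v) (at 0)"
proof -
  obtain l where l: "((\<lambda>t::real. (T (x + t *\<^sub>R v) - T x) /\<^sub>R t) \<longlongrightarrow> l) (at 0)"
    using assms unfolding gateaux_differentiable_def by blast
  then have "gateaux_deriv T x v = l"
    unfolding gateaux_deriv_def by (intro tendsto_Lim) auto
  with l show ?thesis
    by simp
qed

lemma cone_le_gateaux_deriv: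
  fixes T :: "'a::real_normed_vector \<Rightarrow> 'b::real_normed_vector"
  assumes "cone C" and "closed K" and "cone K" and "open A"
    and mono: "monotone_on A (cone_le C) (cone_le K) T"
    and diff: "gateaux_differentiable T x"
    and "x \<in> A" and "v \<in> C" and "v \<noteq> 0"
  shows "cone_le K 0 (gateaux_deriv T x v)"
proof -
  let ?q = "\<lambda>t::real. (T (x + t *\<^sub>R v) - T x) /\<^sub>R t"
  \<comment> \<open>The two-sided limit is restricted to \<open>t > 0\<close>, where both
    \<open>t\<close> and its inverse are scalings that preserve the cones.\<close>
  have "(?q \<longlongrightarrow> gateaux_deriv T x v) (at_right 0)"
    using gateaux_deriv_tendsto[OF diff \<open>v \<noteq> 0\<close>]
    by (rule filterlim_mono) (auto simp: at_le)
  moreover have "\<forall>\<^sub>F t in at_right 0. ?q t \<in> K"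
  proof -
    \<comment> \<open>Monotonicity is known only on \<open>A\<close>; openness keeps the moved point
      in \<open>A\<close> for small \<open>t\<close>.\<close>
    have "((\<lambda>t::real. x + t *\<^sub>R v) \<longlongrightarrow> x) (at_right 0)"
      by (auto intro!: tendsto_eq_intros)
    then have "\<forall>\<^sub>F t::real in at_right 0. x + t *\<^sub>R v \<in> A"
      using \<open>open A\<close> \<open>x \<in> A\<close> by (rule topological_tendstoD)
    moreover have "\<forall>\<^sub>F t::real in at_right 0. t > 0"
      by (rule eventually_at_right_less)
    ultimately show ?thesis
    proof eventually_elim
      case (elim t)
      have "cone_le C x (x + t *\<^sub>R v)"
        using \<open>cone C\<close> \<open>v \<in> C\<close> elim by (simp add: cone_le_def mem_cone)
      then have "T (x + t *\<^sub>R v) - T x \<in> K"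
        using monotone_onD[OF mono \<open>x \<in> A\<close>] elim by (simp add: cone_le_def)
      then show ?case
        using \<open>cone K\<close> elim by (simp add: mem_cone)
    qed
  qed
  \<comment> \<open>A closed set contains the limit of values that eventually lie in it, the filter
    being nontrivial.\<close>
  ultimately have "gateaux_deriv T x v \<in> K"
    using \<open>closed K\<close> by (intro Lim_in_closed_set[where F = "at_right 0" and f = ?q]) auto
  then show ?thesis
    by (simp add: cone_le_def)
qed

text \<open>The chain rule along the line through \<open>x\<close> in direction \<open>v\<close>
  gives a derivative at \<open>0\<close> in the real variable \<open>t\<close>; homogeneity of
  \<open>T'\<close> turns its remainder estimate into convergence of the quotients.\<close>

lemma has_derivative_directional_tendsto:
  assumes "(T has_derivative T') (at x)"
  shows "((\<lambda>t::real. (T (x + t *\<^sub>R v) - T x) /\<^sub>R t) \<longlongrightarrow> T' v) (at 0)"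
proof -
  interpret T': bounded_linear T'
    using assms by (rule has_derivative_bounded_linear)
  have "((\<lambda>t::real. x + t *\<^sub>R v) has_derivative (\<lambda>t. t *\<^sub>R v)) (at 0)"
    by (auto intro!: derivative_eq_intros)
  then have "((\<lambda>t::real. T (x + t *\<^sub>R v)) has_derivative (\<lambda>t. T' (t *\<^sub>R v))) (at 0)"
    by (rule has_derivative_compose) (simp add: assms)
  then have "((\<lambda>t::real. norm (T (x + t *\<^sub>R v) - T x - T' (t *\<^sub>R v)) / norm t) \<longlongrightarrow> 0) (at 0)"
    by (simp add: has_derivative_iff_norm)
  moreover have "\<forall>\<^sub>F t::real in at 0.
      norm (T (x + t *\<^sub>R v) - T x - T' (t *\<^sub>R v)) / norm t
        = norm ((T (x + t *\<^sub>R v) - T x) /\<^sub>R t - T' v)"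
    \<comment> \<open>Only \<open>t \<noteq> 0\<close> matters: at \<open>t = 0\<close> division by
      zero makes the left side \<open>0\<close>, while the right side is
      \<open>norm (T' v)\<close>.\<close>
    unfolding eventually_at_filter
  proof (intro always_eventually allI impI)
    fix t :: real
    assume "t \<noteq> 0"
    then have "(T (x + t *\<^sub>R v) - T x) /\<^sub>R t - T' v = (T (x + t *\<^sub>R v) - T x - T' (t *\<^sub>R v)) /\<^sub>R t"
      by (simp add: T'.scaleR scaleR_diff_right)
    then show "norm (T (x + t *\<^sub>R v) - T x - T' (t *\<^sub>R v)) / norm t
        = norm ((T (x + t *\<^sub>R v) - T x) /\<^sub>R t - T' v)"
      by (simp add: divide_inverse_commute)
  qed
  ultimately have "((\<lambda>t::real. norm ((T (x + t *\<^sub>R v) - T x) /\<^sub>R t - T' v)) \<longlongrightarrow> 0) (at 0)"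
    by (rule Lim_transform_eventually)
  then show ?thesis
    by (rule LIM_zero_cancel[OF tendsto_norm_zero_cancel])
qed

lemma differentiable_imp_gateaux_differentiable:
  assumes "T differentiable (at x)"
  shows "gateaux_differentiable T x"
  using assms has_derivative_directional_tendsto
  unfolding differentiable_def gateaux_differentiable_def by blast

text \<open>Uniqueness of limits identifies the \<open>Lim\<close> value with the limit supplied by
  the Frechet derivative.\<close>

lemma gateaux_deriv_eq_frechet_derivative:
  assumes "T differentiable (at x)"
  shows "gateaux_deriv T x v = frechet_derivative T (at x) v"
  using assms unfolding gateaux_deriv_def
  by (intro tendsto_Lim has_derivative_directional_tendsto)
     (auto simp: frechet_derivative_works)

theorem theorem2p9:
  fixes C :: "'a::banach set" and K :: "'b::banach set"
    and A :: "'a set" and T :: "'a \<Rightarrow> 'b"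
  assumes "closed C" and "convex C" and "cone C" and "pointed C" and "C \<noteq> {0}"
    and "closed K" and "convex K" and "cone K" and "pointed K" and "K \<noteq> {0}"
    and "A \<noteq> {}" and "convex A" and "open A"
  shows "((\<forall>x\<in>A. gateaux_differentiable T x) \<longrightarrow>
           monotone_on A (cone_le C) (cone_le K) T \<longrightarrow>
           (\<forall>x\<in>A. \<forall>v\<in>C - {0}. cone_le K 0 (gateaux_deriv T x v)))
       \<and> ((\<forall>x\<in>A. T differentiable (at x)) \<longrightarrow>
           monotone_on A (cone_le C) (cone_le K) T \<longrightarrow>
           (\<forall>x\<in>A. gateaux_differentiable T x \<and>
             (\<forall>v\<in>C - {0}. frechet_derivative T (at x) v = gateaux_deriv T x v
                         \<and> cone_le K 0 (gateaux_deriv T x v))))"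
proof (intro conjI impI ballI)
  fix x v
  assume "monotone_on A (cone_le C) (cone_le K) T" and "x \<in> A" and "v \<in> C - {0}"
  \<comment> \<open>Differentiability at \<open>x\<close> stays a premise here, so that the fact
    serves both halves of the theorem.\<close>
  then have cone: "cone_le K 0 (gateaux_deriv T x v)" if "gateaux_differentiable T x"
    using cone_le_gateaux_deriv[OF \<open>cone C\<close> \<open>closed K\<close> \<open>cone K\<close> \<open>open A\<close>] that by blast
  show "cone_le K 0 (gateaux_deriv T x v)" if "\<forall>x\<in>A. gateaux_differentiable T x"
    using cone that \<open>x \<in> A\<close> by blast
  show "cone_le K 0 (gateaux_deriv T x v)" if "\<forall>x\<in>A. T differentiable (at x)"
    using cone that \<open>x \<in> A\<close> differentiable_imp_gateaux_differentiable by blast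
qed (simp_all add: differentiable_imp_gateaux_differentiable gateaux_deriv_eq_frechet_derivative)

end
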